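(* Let $F$ be a non-discrete locally compact non-archimedean field of characteristic $\neq 2$, with residue field of characteristic $p$ and cardinality $q$. Let $R$ be an integral domain with $p\in R^\times$, containing a square root of $q$, and let $\chi:F\to R^\times$ be a non-trivial smooth character. Let $X$ be a finite-dimensional $F$-vector space, $W=X\times X^*$, and let $\mathrm{Mp}(W)$ be the metaplectic group attached to $R$ and $\chi$. Then the map $$\mathrm{Mp}(W)\longrightarrow\mathbb B_0(W)\subset\mathrm{Aut}(\mathcal S(X)),\qquad(\sigma,\mathbf s)\longmapsto\mathbf s$$ is a faithful representation of $\mathrm{Mp}(W)$ on the $R$-module $\mathcal S(X)$ that lifts $\mu$, i.e. it is an injective group homomorphism and $\pi_0(\mathbf s)=\mu(\sigma)$ for all $(\sigma,\mathbf s)\in\mathrm{Mp}(W)$.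
   Context: A smooth character of $F$ is a group homomorphism $F\to R^\times$ with open kernel. $X^*=\mathrm{Hom}_F(X,F)$; $[x,x^*]=x^*(x)$ and $\langle x,x^*\rangle=\chi([x,x^*])$. On $W=X\times X^*$ put $\mathcal B((x_1,x_1^* ),(x_2,x_2^* ))=[x_1,x_2^*]$ and $\mathcal F=\chi\circ\mathcal B$. $\mathrm{Sp}(W)$ is the group of $F$-linear automorphisms $\sigma$ of $W$ preserving the form $(w_1,w_2)\mapsto\mathcal B(w_1,w_2)-\mathcal B(w_2,w_1)$. For $\sigma\in\mathrm{Sp}(W)$ put $f_\sigma(w)=\frac12(\mathcal B(\sigma w,\sigma w)-\mathcal B(w,w))$. $A(W)$ is the set $W\times R^\times$ with group law $(w_1,t_1)(w_2,t_2)=(w_1+w_2,t_1t_2\mathcal F(w_1,w_2))$; its center is $Z=\{(0,t):t\in R^\times\}$. $B_0(W)$ is the group of automorphisms of $A(W)$ acting trivially on $Z$. $\mathcal S(X)$ is the $R$-module of locally constant compactly supported functions $X\to R$, and $\mathrm{Aut}(\mathcal S(X))$ its group of $R$-linear automorphisms. For $w=(v,v^* )\in W$ and $t\in R^\times$, $U(w,t)\in\mathrm{Aut}(\mathcal S(X))$ is $(U(w,t)\Phi)(x)=t\,\Phi(x+v)\langle x,v^*\rangle$; the map $U$ is an isomorphism from $A(W)$ onto a subgroup $\mathbb A(W)$ of $\mathrm{Aut}(\mathcal S(X))$. $\mathbb B_0(W)$ is the normalizer of $\mathbb A(W)$ in $\mathrm{Aut}(\mathcal S(X))$. The homomorphism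 $\pi_0:\mathbb B_0(W)\to B_0(W)$ sends $\mathbf s$ to conjugation by $\mathbf s$ on $\mathbb A(W)\cong A(W)$ (identified via $U$). The homomorphism $\mu:\mathrm{Sp}(W)\to B_0(W)$ sends $\sigma$ to the automorphism $(w,t)\mapsto(\sigma(w),\chi(f_\sigma(w))t)$. The metaplectic group is $\mathrm{Mp}(W)=\{(\sigma,\mathbf s)\in\mathrm{Sp}(W)\times\mathbb B_0(W):\mu(\sigma)=\pi_0(\mathbf s)\}$. *)

theory Defs
  imports
    "HOL-Computational_Algebra.Computational_Algebra"
    "HOL-Library.Function_Algebras"
    "HOL-Analysis.Abstract_Metric_Spaces"
    "HOL-Algebra.Bij"
    "HOL-Algebra.Group_Action"
    "HOL-Algebra.QuotRing"
begin

text \<open>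
  \<open>F\<close> is a field type \<open>'f\<close> with an absolute value \<open>v\<close>, \<open>R\<close> is an
  integral domain type \<open>'r\<close>, and \<open>X\<close> is a type \<open>'x\<close> with scalar
  multiplication \<open>smul\<close>. Sums of functions and of pairs are the pointwise and componentwise
  ones. Elements of automorphism groups of a set \<open>S\<close> are, as in \<^const>\<open>BijGroup\<close>,
  bijections of \<open>S\<close> that are \<^const>\<open>undefined\<close> outside \<open>S\<close>.
\<close>

section \<open>Local fields and smooth characters\<close>

definition F_topology :: "('f::field \<Rightarrow> real) \<Rightarrow> 'f topology" where
  "F_topology v = Metric_space.mtopology UNIV (\<lambda>x y. v (x - y))"

locale nonarch_local_field =
  fixes v :: "'f::field \<Rightarrow> real"
  assumes nonneg: "0 \<le> v x"
    and eq_0_iff: "v x = 0 \<longleftrightarrow> x = 0"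
    and mult: "v (x * y) = v x * v y"
    and ultrametric: "v (x + y) \<le> max (v x) (v y)"
    and non_discrete: "F_topology v \<noteq> discrete_topology UNIV"
    and locally_compact: "locally_compact_space (F_topology v)"

definition valuation_ring :: "('f::field \<Rightarrow> real) \<Rightarrow> 'f ring" where
  "valuation_ring v =
     \<lparr>carrier = {x. v x \<le> 1}, mult = (*), one = 1, zero = 0, add = (+)\<rparr>"

definition residue_field :: "('f::field \<Rightarrow> real) \<Rightarrow> 'f set ring" where
  "residue_field v = valuation_ring v Quot {x. v x < 1}"

text \<open>The counterpart of \<open>CHAR('a)\<close> for rings given as records.\<close>

definition ring_characteristic :: "('a, 'b) ring_scheme \<Rightarrow> nat" where
  "ring_characteristic K = Gcd {n. add_pow K n \<one>\<^bsub>K\<^esub> = \<zero>\<^bsub>K\<^esub>}"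

definition smooth_character :: "('f::field \<Rightarrow> real) \<Rightarrow> ('f \<Rightarrow> 'r::idom) \<Rightarrow> bool" where
  "smooth_character v chi \<longleftrightarrow>
     (\<forall>x. chi x dvd 1) \<and> (\<forall>x y. chi (x + y) = chi x * chi y) \<and> openin (F_topology v) {x. chi x = 1}"


section \<open>The symplectic space \<open>W = X \<times> X\<^sup>*\<close> and its symplectic group\<close>

definition dual_space :: "('f::field \<Rightarrow> 'x::ab_group_add \<Rightarrow> 'x) \<Rightarrow> ('x \<Rightarrow> 'f) set" where
  "dual_space smul = {f. Vector_Spaces.linear smul (*) f}"

definition W_space :: "('f::field \<Rightarrow> 'x::ab_group_add \<Rightarrow> 'x) \<Rightarrow> ('x \<times> ('x \<Rightarrow> 'f)) set" where
  "W_space smul = UNIV \<times> dual_space smul"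

definition W_scale ::
    "('f::field \<Rightarrow> 'x::ab_group_add \<Rightarrow> 'x) \<Rightarrow> 'f \<Rightarrow> 'x \<times> ('x \<Rightarrow> 'f) \<Rightarrow> 'x \<times> ('x \<Rightarrow> 'f)" where
  "W_scale smul c w = (smul c (fst w), \<lambda>x. c * snd w x)"

definition B_form :: "'x \<times> ('x \<Rightarrow> 'f) \<Rightarrow> 'x \<times> ('x \<Rightarrow> 'f) \<Rightarrow> 'f" where
  "B_form w\<^sub>1 w\<^sub>2 = snd w\<^sub>2 (fst w\<^sub>1)"

definition Sp :: "('f::field \<Rightarrow> 'x::ab_group_add \<Rightarrow> 'x) \<Rightarrow>
    ('x \<times> ('x \<Rightarrow> 'f) \<Rightarrow> 'x \<times> ('x \<Rightarrow> 'f)) monoid" where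
  "Sp smul = (BijGroup (W_space smul))\<lparr>carrier := {\<sigma> \<in> Bij (W_space smul).
     (\<forall>w\<^sub>1\<in>W_space smul. \<forall>w\<^sub>2\<in>W_space smul. \<sigma> (w\<^sub>1 + w\<^sub>2) = \<sigma> w\<^sub>1 + \<sigma> w\<^sub>2) \<and>
     (\<forall>c. \<forall>w\<in>W_space smul. \<sigma> (W_scale smul c w) = W_scale smul c (\<sigma> w)) \<and>
     (\<forall>w\<^sub>1\<in>W_space smul. \<forall>w\<^sub>2\<in>W_space smul.
        B_form (\<sigma> w\<^sub>1) (\<sigma> w\<^sub>2) - B_form (\<sigma> w\<^sub>2) (\<sigma> w\<^sub>1) = B_form w\<^sub>1 w\<^sub>2 - B_form w\<^sub>2 w\<^sub>1)}\<rparr>"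

definition f_quad ::
    "('x \<times> ('x \<Rightarrow> 'f) \<Rightarrow> 'x \<times> ('x \<Rightarrow> 'f)) \<Rightarrow> 'x \<times> ('x \<Rightarrow> 'f) \<Rightarrow> 'f::field" where
  "f_quad \<sigma> w = (B_form (\<sigma> w) (\<sigma> w) - B_form w w) / 2"


section \<open>The group \<open>A(W)\<close>, its automorphisms \<open>B\<^sub>0(W)\<close>, and \<open>\<mu>\<close>\<close>

definition A_group :: "('f::field \<Rightarrow> 'x::ab_group_add \<Rightarrow> 'x) \<Rightarrow> ('f \<Rightarrow> 'r::idom) \<Rightarrow>
    (('x \<times> ('x \<Rightarrow> 'f)) \<times> 'r) monoid" where
  "A_group smul chi =
     \<lparr>carrier = W_space smul \<times> {t. t dvd 1},
      mult = (\<lambda>(w\<^sub>1, t\<^sub>1) (w\<^sub>2, t\<^sub>2). (w\<^sub>1 + w\<^sub>2, t\<^sub>1 * t\<^sub>2 * chi (B_form w\<^sub>1 w\<^sub>2))),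
      one = (0, 1)\<rparr>"

text \<open>
  The common codomain of \<open>mu_map\<close> and \<open>pi0_map\<close> below, which produce functions on the
  carrier of \<open>A(W)\<close> in the sense of \<^const>\<open>BijGroup\<close>.
\<close>

definition B0_group :: "('f::field \<Rightarrow> 'x::ab_group_add \<Rightarrow> 'x) \<Rightarrow> ('f \<Rightarrow> 'r::idom) \<Rightarrow>
    (('x \<times> ('x \<Rightarrow> 'f)) \<times> 'r \<Rightarrow> ('x \<times> ('x \<Rightarrow> 'f)) \<times> 'r) monoid" where
  "B0_group smul chi = (AutoGroup (A_group smul chi))\<lparr>carrier :=
     {\<alpha> \<in> auto (A_group smul chi). \<forall>t. t dvd 1 \<longrightarrow> \<alpha> (0, t) = (0, t)}\<rparr>"

definition mu_map :: "('f::field \<Rightarrow> 'x::ab_group_add \<Rightarrow> 'x) \<Rightarrow> ('f \<Rightarrow> 'r::idom) \<Rightarrow>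
    ('x \<times> ('x \<Rightarrow> 'f) \<Rightarrow> 'x \<times> ('x \<Rightarrow> 'f)) \<Rightarrow> ('x \<times> ('x \<Rightarrow> 'f)) \<times> 'r \<Rightarrow> ('x \<times> ('x \<Rightarrow> 'f)) \<times> 'r" where
  "mu_map smul chi \<sigma> =
     (\<lambda>(w, t)\<in>carrier (A_group smul chi). (\<sigma> w, chi (f_quad \<sigma> w) * t))"


section \<open>The Schwartz space and the group \<open>\<bbbB>\<^sub>0(W)\<close>\<close>

text \<open>
  The coarsest topology on \<open>X\<close> making all linear forms continuous; for finite-dimensional
  \<open>X\<close> this is the product topology of \<open>F\<^sup>n\<close> with respect to any basis.
\<close>

definition X_topology ::
    "('f::field \<Rightarrow> real) \<Rightarrow> ('f \<Rightarrow> 'x::ab_group_add \<Rightarrow> 'x) \<Rightarrow> 'x topology" where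
  "X_topology v smul =
     topology_generated_by {f -` U | f U. f \<in> dual_space smul \<and> openin (F_topology v) U}"

definition schwartz_space :: "'x topology \<Rightarrow> ('x \<Rightarrow> 'r::idom) set" where
  "schwartz_space T =
     {\<Phi>. (\<forall>x\<in>topspace T. \<exists>U. openin T U \<and> x \<in> U \<and> (\<forall>y\<in>U. \<Phi> y = \<Phi> x)) \<and>
         compactin T (T closure_of {x \<in> topspace T. \<Phi> x \<noteq> 0})}"

definition Aut_module :: "('x \<Rightarrow> 'r::idom) set \<Rightarrow> (('x \<Rightarrow> 'r) \<Rightarrow> ('x \<Rightarrow> 'r)) monoid" where
  "Aut_module S = (BijGroup S)\<lparr>carrier := {s \<in> Bij S.
     (\<forall>\<Phi>\<in>S. \<forall>\<Psi>\<in>S. s (\<Phi> + \<Psi>) = s \<Phi> + s \<Psi>) \<and>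
     (\<forall>r. \<forall>\<Phi>\<in>S. s (\<lambda>x. r * \<Phi> x) = (\<lambda>x. r * s \<Phi> x))}\<rparr>"

definition U_map :: "('f::field \<Rightarrow> real) \<Rightarrow> ('f \<Rightarrow> 'x::ab_group_add \<Rightarrow> 'x) \<Rightarrow> ('f \<Rightarrow> 'r::idom) \<Rightarrow>
    ('x \<times> ('x \<Rightarrow> 'f)) \<times> 'r \<Rightarrow> ('x \<Rightarrow> 'r) \<Rightarrow> ('x \<Rightarrow> 'r)" where
  "U_map v smul chi = (\<lambda>((y, y'), t). \<lambda>\<Phi>\<in>schwartz_space (X_topology v smul).
     (\<lambda>x. t * \<Phi> (x + y) * chi (y' x)))"

definition AA_group :: "('f::field \<Rightarrow> real) \<Rightarrow> ('f \<Rightarrow> 'x::ab_group_add \<Rightarrow> 'x) \<Rightarrow> ('f \<Rightarrow> 'r::idom) \<Rightarrow>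
    (('x \<Rightarrow> 'r) \<Rightarrow> ('x \<Rightarrow> 'r)) set" where
  "AA_group v smul chi = U_map v smul chi ` carrier (A_group smul chi)"

definition BB0_group :: "('f::field \<Rightarrow> real) \<Rightarrow> ('f \<Rightarrow> 'x::ab_group_add \<Rightarrow> 'x) \<Rightarrow> ('f \<Rightarrow> 'r::idom) \<Rightarrow>
    (('x \<Rightarrow> 'r) \<Rightarrow> ('x \<Rightarrow> 'r)) monoid" where
  "BB0_group v smul chi =
     (let G = Aut_module (schwartz_space (X_topology v smul))
      in G\<lparr>carrier := normalizer G (AA_group v smul chi)\<rparr>)"

definition pi0_map :: "('f::field \<Rightarrow> real) \<Rightarrow> ('f \<Rightarrow> 'x::ab_group_add \<Rightarrow> 'x) \<Rightarrow> ('f \<Rightarrow> 'r::idom) \<Rightarrow>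
    (('x \<Rightarrow> 'r) \<Rightarrow> ('x \<Rightarrow> 'r)) \<Rightarrow> ('x \<times> ('x \<Rightarrow> 'f)) \<times> 'r \<Rightarrow> ('x \<times> ('x \<Rightarrow> 'f)) \<times> 'r" where
  "pi0_map v smul chi s =
     (\<lambda>a\<in>carrier (A_group smul chi).
        let G = Aut_module (schwartz_space (X_topology v smul))
        in the_inv_into (carrier (A_group smul chi)) (U_map v smul chi)
             (s \<otimes>\<^bsub>G\<^esub> U_map v smul chi a \<otimes>\<^bsub>G\<^esub> inv\<^bsub>G\<^esub> s))"


section \<open>The metaplectic group\<close>

definition Mp :: "('f::field \<Rightarrow> real) \<Rightarrow> ('f \<Rightarrow> 'x::ab_group_add \<Rightarrow> 'x) \<Rightarrow> ('f \<Rightarrow> 'r::idom) \<Rightarrow>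
    (('x \<times> ('x \<Rightarrow> 'f) \<Rightarrow> 'x \<times> ('x \<Rightarrow> 'f)) \<times> (('x \<Rightarrow> 'r) \<Rightarrow> ('x \<Rightarrow> 'r))) monoid" where
  "Mp v smul chi = (Sp smul \<times>\<times> BB0_group v smul chi)\<lparr>carrier :=
     {(\<sigma>, s). \<sigma> \<in> carrier (Sp smul) \<and> s \<in> carrier (BB0_group v smul chi) \<and>
        mu_map smul chi \<sigma> = pi0_map v smul chi s}\<rparr>"

end

theory Submission
  imports Defs
begin

text \<open>
  Everything rests on \<open>U\<close> being injective: an element of the normalizer is then compatible with at
  most one automorphism of \<open>A(W)\<close>, which makes \<open>\<pi>\<^sub>0\<close> multiplicative. Injectivity follows from small
  compact open boxes around \<open>0\<close> in \<open>X\<close>, whose indicator functions separate translations, and from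
  the fact that a nonzero linear form composed with \<open>\<chi>\<close> is nontrivial.
  Since \<open>f\<^bsub>\<sigma>\<tau>\<^esub> = f\<^bsub>\<sigma>\<^esub> \<circ> \<tau> + f\<^bsub>\<tau>\<^esub>\<close>, \<open>\<mu>\<close> is multiplicative as well, so \<open>Mp(W)\<close> is a fibre product
  of groups; the projection to the second factor is injective because \<open>\<mu>(\<sigma>)\<close> determines \<open>\<sigma>\<close>.
\<close>

section \<open>Topology of \<open>F\<close>\<close>

context nonarch_local_field
begin

section \<open>The absolute value and its metric\<close>

lemma v_0 [simp]: "v 0 = 0"
  by (simp add: eq_0_iff)

lemma v_1 [simp]: "v 1 = 1"
  using mult[of 1 1] eq_0_iff[of 1] by simp

lemma v_minus_1: "v (- 1) = 1"
proof -
  have "v (- 1) * v (- 1) = 1"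
    by (simp flip: mult)
  then show ?thesis
    using nonneg[of "- 1"] by (metis abs_of_nonneg abs_mult_self_eq real_sqrt_abs2 real_sqrt_one)
qed

lemma v_uminus [simp]: "v (- x) = v x"
  using mult[of "- 1" x] by (simp add: v_minus_1)

lemma v_diff_commute: "v (x - y) = v (y - x)"
  by (metis minus_diff_eq v_uminus)

sublocale F_metric: Metric_space UNIV "\<lambda>x y. v (x - y)"
proof
  fix x y z
  show "v (x - z) \<le> v (x - y) + v (y - z)"
    using ultrametric[of "x - y" "y - z"] nonneg[of "x - y"] nonneg[of "y - z"] by simp
qed (auto simp: nonneg eq_0_iff v_diff_commute)

section \<open>Open sets and balls in \<open>F\<close>\<close>

lemma topspace_F [simp]: "topspace (F_topology v) = UNIV"
  by (simp add: F_topology_def)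

lemma openin_F_iff:
  "openin (F_topology v) U \<longleftrightarrow> (\<forall>x\<in>U. \<exists>e>0. \<forall>y. v (x - y) < e \<longrightarrow> y \<in> U)"
  by (auto simp: F_topology_def F_metric.openin_mtopology subset_iff)

lemma openin_F_translate:
  assumes "openin (F_topology v) U"
  shows "openin (F_topology v) {x. x + c \<in> U}"
  unfolding openin_F_iff
proof
  fix x assume "x \<in> {x. x + c \<in> U}"
  then obtain e where "e > 0" "\<And>y. v (x + c - y) < e \<Longrightarrow> y \<in> U"
    using assms unfolding openin_F_iff by blast
  then show "\<exists>e>0. \<forall>y. v (x - y) < e \<longrightarrow> y \<in> {x. x + c \<in> U}"
    by (intro exI[of _ e]) auto
qed

text \<open>Both directions are the ultrametric inequality, applied to
  \<open>x = (x - y) + y\<close> and its mirror image. This is why balls around 0 are open and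
  closed at once.\<close>

lemma v_le_iff_of_close:
  assumes "v (x - y) \<le> e"
  shows "v x \<le> e \<longleftrightarrow> v y \<le> e"
  using assms ultrametric[of "x - y" y] ultrametric[of "y - x" x] v_diff_commute[of x y] by auto

lemma openin_F_ball:
  assumes "e > 0"
  shows "openin (F_topology v) {x. v x \<le> e}"
  unfolding openin_F_iff
proof
  fix x assume "x \<in> {x. v x \<le> e}"
  then show "\<exists>e'>0. \<forall>y. v (x - y) < e' \<longrightarrow> y \<in> {x. v x \<le> e}"
    using assms v_le_iff_of_close[of x _ e] by (intro exI[of _ e]) auto
qed

lemma closedin_F_ball:
  assumes "e > 0"
  shows "closedin (F_topology v) {x. v x \<le> e}"
proof -
  have "openin (F_topology v) (- {x. v x \<le> e})"
    unfolding openin_F_iff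
  proof
    fix x assume "x \<in> - {x. v x \<le> e}"
    then show "\<exists>e'>0. \<forall>y. v (x - y) < e' \<longrightarrow> y \<in> - {x. v x \<le> e}"
      using assms v_le_iff_of_close[of x _ e] by (intro exI[of _ e]) fastforce
  qed
  then show ?thesis
    by (simp add: closedin_def Compl_eq_Diff_UNIV)
qed

text \<open>Local compactness at 0 gives a compact neighbourhood; every small enough ball is a
  closed subset of it.\<close>

lemma small_balls_compact:
  obtains e where "e > 0" "\<forall>r. 0 < r \<longrightarrow> r \<le> e \<longrightarrow> compactin (F_topology v) {x. v x \<le> r}"
proof -
  obtain U K where U: "openin (F_topology v) U" "compactin (F_topology v) K" "0 \<in> U" "U \<subseteq> K"
    using locally_compact unfolding locally_compact_space_def by (metis UNIV_I topspace_F)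
  then obtain e where e: "e > 0" "\<And>y. v (0 - y) < e \<Longrightarrow> y \<in> U"
    unfolding openin_F_iff by blast
  \<comment> \<open>\<open>U\<close> contains only the open ball of radius \<open>e\<close>; halving
    makes the closed balls fit inside.\<close>
  have "compactin (F_topology v) {x. v x \<le> r}" if "0 < r" "r \<le> e / 2" for r
  proof (rule closed_compactin[OF U(2) _ closedin_F_ball[OF \<open>0 < r\<close>]])
    show "{x. v x \<le> r} \<subseteq> K"
      using e that U(4) by fastforce
  qed
  with e that[of "e / 2"] show thesis by auto
qed

section \<open>Continuity of maps into \<open>F\<close>\<close>

lemma continuous_map_to_F_iff:
  "continuous_map X (F_topology v) f \<longleftrightarrow>
    (\<forall>x\<in>topspace X. \<forall>e>0. \<exists>U. openin X U \<and> x \<in> U \<and> (\<forall>y\<in>U. v (f x - f y) < e))"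
  by (simp add: F_topology_def F_metric.continuous_map_to_metric)

lemma continuous_map_F_add:
  assumes "continuous_map X (F_topology v) f" "continuous_map X (F_topology v) g"
  shows "continuous_map X (F_topology v) (\<lambda>x. f x + g x)"
  unfolding continuous_map_to_F_iff
proof (intro ballI allI impI)
  fix x and e :: real assume x: "x \<in> topspace X" "e > 0"
  obtain U where U: "openin X U" "x \<in> U" "\<forall>y\<in>U. v (f x - f y) < e"
    using assms(1) x unfolding continuous_map_to_F_iff by blast
  obtain V where V: "openin X V" "x \<in> V" "\<forall>y\<in>V. v (g x - g y) < e"
    using assms(2) x unfolding continuous_map_to_F_iff by blast
  \<comment> \<open>By the ultrametric inequality the same \<open>e\<close> serves both summands and
    their sum.\<close>
  have "v (f x + g x - (f y + g y)) < e" if "y \<in> U \<inter> V" for y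
    using that U(3) V(3) ultrametric[of "f x - f y" "g x - g y"]
    by (force simp: algebra_simps)
  with U V show "\<exists>U. openin X U \<and> x \<in> U \<and> (\<forall>y\<in>U. v (f x + g x - (f y + g y)) < e)"
    by (intro exI[of _ "U \<inter> V"]) auto
qed

lemma continuous_map_F_mult_right:
  assumes "continuous_map X (F_topology v) f"
  shows "continuous_map X (F_topology v) (\<lambda>x. f x * a)"
proof (cases "a = 0")
  case True
  then show ?thesis by simp
next
  case False
  then have a: "v a > 0"
    using nonneg[of a] eq_0_iff[of a] by linarith
  show ?thesis
    unfolding continuous_map_to_F_iff
  proof (intro ballI allI impI)
    fix x and e :: real assume "x \<in> topspace X" "e > 0"
    moreover from this have "e / v a > 0"
      using a by simp
    ultimately obtain U where "openin X U" "x \<in> U" "\<forall>y\<in>U. v (f x - f y) < e / v a"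
      using assms unfolding continuous_map_to_F_iff by blast
    then show "\<exists>U. openin X U \<and> x \<in> U \<and> (\<forall>y\<in>U. v (f x * a - f y * a) < e)"
      using a by (intro exI[of _ U]) (auto simp: left_diff_distrib[symmetric] mult pos_less_divide_eq)
  qed
qed

lemma continuous_map_F_sum:
  assumes "finite I" "\<And>i. i \<in> I \<Longrightarrow> continuous_map X (F_topology v) (f i)"
  shows "continuous_map X (F_topology v) (\<lambda>x. \<Sum>i\<in>I. f i x)"
  using assms by (induction I rule: finite_induct) (auto intro: continuous_map_F_add)

end


section \<open>Schwartz functions\<close>

text \<open>Local constancy means that every level set is open. The complement of the zero level is
  then already closed, so taking its closure changes nothing.\<close>

lemma schwartz_space_iff:
  assumes T: "topspace T = UNIV"
  shows "\<Phi> \<in> schwartz_space T \<longleftrightarrow>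
    (\<forall>c. openin T {x. \<Phi> x = c}) \<and> compactin T {x. \<Phi> x \<noteq> 0}"
proof -
  have loc: "(\<forall>x. \<exists>U. openin T U \<and> x \<in> U \<and> (\<forall>y\<in>U. \<Phi> y = \<Phi> x)) \<longleftrightarrow> (\<forall>c. openin T {x. \<Phi> x = c})"
    (is "?L \<longleftrightarrow> ?R")
  proof
    assume ?L
    show ?R
    proof (intro allI, subst openin_subopen, intro ballI)
      fix c x assume x: "x \<in> {x. \<Phi> x = c}"
      from \<open>?L\<close> obtain U where "openin T U" "x \<in> U" "\<forall>y\<in>U. \<Phi> y = \<Phi> x"
        by blast
      moreover from this x have "U \<subseteq> {x. \<Phi> x = c}"
        by (metis (mono_tags, lifting) mem_Collect_eq subsetI)
      ultimately show "\<exists>U. openin T U \<and> x \<in> U \<and> U \<subseteq> {x. \<Phi> x = c}"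
        by blast
    qed
  next
    assume ?R
    show ?L
    proof
      fix x
      show "\<exists>U. openin T U \<and> x \<in> U \<and> (\<forall>y\<in>U. \<Phi> y = \<Phi> x)"
        using \<open>?R\<close> by (intro exI[of _ "{y. \<Phi> y = \<Phi> x}"]) auto
    qed
  qed
  have "T closure_of {x. \<Phi> x \<noteq> 0} = {x. \<Phi> x \<noteq> 0}" if "\<forall>c. openin T {x. \<Phi> x = c}"
  proof -
    have "closedin T {x. \<Phi> x \<noteq> 0}"
      using that by (simp add: closedin_def T Diff_eq Collect_neg_eq[symmetric])
    then show ?thesis by (rule closure_of_closedin)
  qed
  with loc show ?thesis
    by (auto simp: schwartz_space_def T)
qed

text \<open>Open level sets make the support closed, so a compact set around it suffices.\<close>

lemma schwartz_space_closed_support: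
  assumes "topspace T = UNIV" "\<forall>c. openin T {x. \<Phi> x = c}"
    and "compactin T K" "{x. \<Phi> x \<noteq> 0} \<subseteq> K"
  shows "\<Phi> \<in> schwartz_space T"
proof -
  have "closedin T {x. \<Phi> x \<noteq> 0}"
    using assms(1,2) by (simp add: closedin_def Diff_eq Collect_neg_eq[symmetric])
  then show ?thesis
    using assms closed_compactin by (auto simp: schwartz_space_iff)
qed

text \<open>A level set of the combination is a union, over all pairs of values with the right
  result, of intersections of two level sets.\<close>

lemma openin_level_combine:
  assumes "\<forall>c. openin T {x. f x = c}" "\<forall>c. openin T {x. g x = c}"
  shows "openin T {x. h (f x) (g x) = c}"
proof -
  have "{x. h (f x) (g x) = c} = (\<Union>(a, b)\<in>{(a, b). h a b = c}. {x. f x = a} \<inter> {x. g x = b})"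
    by auto
  also have "openin T \<dots>"
    using assms by (intro openin_Union) auto
  finally show ?thesis .
qed

lemma schwartz_space_add:
  assumes T: "topspace T = UNIV" and "\<Phi> \<in> schwartz_space T" "\<Psi> \<in> schwartz_space T"
  shows "\<Phi> + \<Psi> \<in> schwartz_space T"
proof (rule schwartz_space_closed_support[OF T])
  show "\<forall>c. openin T {x. (\<Phi> + \<Psi>) x = c}"
    using assms openin_level_combine[where h = "(+)"] by (auto simp: schwartz_space_iff)
  show "compactin T ({x. \<Phi> x \<noteq> 0} \<union> {x. \<Psi> x \<noteq> 0})"
    using assms by (intro compactin_Un) (auto simp: schwartz_space_iff)
qed auto

lemma schwartz_space_scale:
  assumes T: "topspace T = UNIV" and "\<Phi> \<in> schwartz_space T"
  shows "(\<lambda>x. r * \<Phi> x) \<in> schwartz_space T"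
proof (rule schwartz_space_closed_support[OF T])
  show "\<forall>c. openin T {x. r * \<Phi> x = c}"
    using assms openin_level_combine[of T \<Phi> \<Phi> "\<lambda>a b. r * a"] by (auto simp: schwartz_space_iff)
  show "compactin T {x. \<Phi> x \<noteq> 0}"
    using assms by (auto simp: schwartz_space_iff)
qed auto


section \<open>Groups of structure-preserving bijections\<close>

lemma BijGroup_mult: "\<lbrakk>g \<in> Bij S; h \<in> Bij S\<rbrakk> \<Longrightarrow> g \<otimes>\<^bsub>BijGroup S\<^esub> h = compose S g h"
  by (simp add: BijGroup_def)

lemma Bij_mem: "\<lbrakk>g \<in> Bij S; x \<in> S\<rbrakk> \<Longrightarrow> g x \<in> S"
  using Bij_imp_funcset by blast

lemma Bij_inv:
  assumes "g \<in> Bij S"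
  obtains h where "h \<in> Bij S" "inv\<^bsub>BijGroup S\<^esub> g = h" "\<And>x. x \<in> S \<Longrightarrow> g (h x) = x" "\<And>x. x \<in> S \<Longrightarrow> h (g x) = x"
proof
  show "inv\<^bsub>BijGroup S\<^esub> g = restrict (inv_into S g) S"
    using assms by (rule inv_BijGroup)
  show "restrict (inv_into S g) S \<in> Bij S"
    using assms by (rule restrict_inv_into_Bij)
qed (use assms in \<open>auto simp: Bij_mem Bij_def bij_betw_def f_inv_into_f inv_into_f_f\<close>)

text \<open>The library inverse is a restricted \<open>inv_into\<close>. The last assumption
  replaces it by any two-sided inverse on \<open>S\<close>, so that closure under inverses can be
  checked by equations.\<close>

lemma subgroup_BijGroupI:
  assumes "C \<subseteq> Bij S"
    and "(\<lambda>x\<in>S. x) \<in> C"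
    and "\<And>g h. g \<in> C \<Longrightarrow> h \<in> C \<Longrightarrow> compose S g h \<in> C"
    and "\<And>g h. \<lbrakk>g \<in> C; h \<in> Bij S; \<And>x. x \<in> S \<Longrightarrow> g (h x) = x; \<And>x. x \<in> S \<Longrightarrow> h (g x) = x\<rbrakk> \<Longrightarrow> h \<in> C"
  shows "subgroup C (BijGroup S)"
proof (rule subgroup.intro)
  show "C \<subseteq> carrier (BijGroup S)" "\<one>\<^bsub>BijGroup S\<^esub> \<in> C"
    using assms by (auto simp: BijGroup_def)
next
  fix g h assume "g \<in> C" "h \<in> C"
  then show "g \<otimes>\<^bsub>BijGroup S\<^esub> h \<in> C"
    using assms(1,3) by (metis BijGroup_mult subsetD)
next
  fix g assume "g \<in> C"
  with assms(1) have "g \<in> Bij S"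
    by blast
  then obtain h where "h \<in> Bij S" "inv\<^bsub>BijGroup S\<^esub> g = h"
    "\<And>x. x \<in> S \<Longrightarrow> g (h x) = x" "\<And>x. x \<in> S \<Longrightarrow> h (g x) = x"
    using Bij_inv by blast
  with \<open>g \<in> C\<close> assms(4) show "inv\<^bsub>BijGroup S\<^esub> g \<in> C"
    by blast
qed

lemma subgroup_Aut_module:
  assumes add: "\<And>\<Phi> \<Psi>. \<Phi> \<in> S \<Longrightarrow> \<Psi> \<in> S \<Longrightarrow> \<Phi> + \<Psi> \<in> S"
    and scale: "\<And>r \<Phi>. \<Phi> \<in> S \<Longrightarrow> (\<lambda>x. r * \<Phi> x) \<in> S"
  shows "subgroup (carrier (Aut_module S)) (BijGroup S)"
proof (rule subgroup_BijGroupI)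
  show "carrier (Aut_module S) \<subseteq> Bij S"
    by (auto simp: Aut_module_def)
  show "(\<lambda>x\<in>S. x) \<in> carrier (Aut_module S)"
    by (auto simp: Aut_module_def id_Bij add scale)
next
  fix g h assume "g \<in> carrier (Aut_module S)" "h \<in> carrier (Aut_module S)"
  then show "compose S g h \<in> carrier (Aut_module S)"
    by (auto simp: Aut_module_def compose_Bij compose_eq add scale Bij_mem)
next
  fix g h assume g: "g \<in> carrier (Aut_module S)" and h: "h \<in> Bij S"
    and gh: "\<And>x. x \<in> S \<Longrightarrow> g (h x) = x" "\<And>x. x \<in> S \<Longrightarrow> h (g x) = x"
  have "h (\<Phi> + \<Psi>) = h \<Phi> + h \<Psi>" if "\<Phi> \<in> S" "\<Psi> \<in> S" for \<Phi> \<Psi>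
  proof -
    \<comment> \<open>Additivity of the inverse is pulled back through \<open>g\<close>; applying
      \<open>h\<close> to both sides finishes.\<close>
    have "g (h \<Phi> + h \<Psi>) = \<Phi> + \<Psi>"
      using g h gh that by (simp add: Aut_module_def Bij_mem)
    then show ?thesis
      using gh(2) add h that by (metis Bij_mem)
  qed
  moreover have "h (\<lambda>x. r * \<Phi> x) = (\<lambda>x. r * h \<Phi> x)" if "\<Phi> \<in> S" for \<Phi> r
  proof -
    have "g (\<lambda>x. r * h \<Phi> x) = (\<lambda>x. r * \<Phi> x)"
      using g h gh that by (simp add: Aut_module_def Bij_mem)
    then show ?thesis
      using gh(2) scale[of "h \<Phi>" r] h that by (metis Bij_mem)
  qed
  ultimately show "h \<in> carrier (Aut_module S)"
    using h by (simp add: Aut_module_def)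
qed

lemma mult_Sp:
  "\<lbrakk>\<sigma> \<in> carrier (Sp smul); \<tau> \<in> carrier (Sp smul)\<rbrakk> \<Longrightarrow>
    \<sigma> \<otimes>\<^bsub>Sp smul\<^esub> \<tau> = compose (W_space smul) \<sigma> \<tau>"
  by (simp add: Sp_def BijGroup_mult)

text \<open>The sum telescopes: \<open>B_form (\<tau> w) (\<tau> w)\<close> occurs once with each
  sign.\<close>

lemma f_quad_compose:
  assumes "w \<in> W"
  shows "f_quad (compose W \<sigma> \<tau>) w = f_quad \<sigma> (\<tau> w) + f_quad \<tau> w"
  using assms by (simp add: f_quad_def compose_eq flip: add_divide_distrib)


section \<open>The Heisenberg group acting on Schwartz functions\<close>

text \<open>A basis is fixed so that coordinates can describe compact open neighbourhoods of 0 in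
  \<open>X\<close>.\<close>

locale schwartz_representation = nonarch_local_field v + finite_dimensional_vector_space smul Basis
  for v :: "'f::field \<Rightarrow> real" and smul :: "'f \<Rightarrow> 'x::ab_group_add \<Rightarrow> 'x" and Basis +
  fixes chi :: "'f \<Rightarrow> 'r::idom"
  assumes smooth: "smooth_character v chi"
    and nontrivial: "\<exists>x. chi x \<noteq> 1"
begin

abbreviation "T \<equiv> X_topology v smul"
abbreviation "S \<equiv> schwartz_space T :: ('x \<Rightarrow> 'r) set"
abbreviation "W \<equiv> W_space smul"
abbreviation "A \<equiv> A_group smul chi"
abbreviation "G \<equiv> Aut_module S"

lemma chi_unit: "chi x dvd 1"
  and chi_add: "chi (x + y) = chi x * chi y"
  and openin_kernel: "openin (F_topology v) {x. chi x = 1}"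
  using smooth by (auto simp: smooth_character_def)

lemma chi_nonzero [simp]: "chi x \<noteq> 0"
  using chi_unit[of x] by auto

lemma chi_0 [simp]: "chi 0 = 1"
  using chi_add[of 0 0] by simp

lemma chi_minus: "chi (- x) * chi x = 1"
  using chi_add[of "- x" x] by simp

text \<open>Library linearity also demands the vector space axioms for source and target. These hold
  here, which leaves the two equations.\<close>

lemma dual_space_iff:
  "f \<in> dual_space smul \<longleftrightarrow> (\<forall>x y. f (x + y) = f x + f y) \<and> (\<forall>c x. f (smul c x) = c * f x)"
proof -
  have "vector_space ((*) :: 'f \<Rightarrow> 'f \<Rightarrow> 'f)"
    by unfold_locales (auto simp: algebra_simps)
  then show ?thesis
    by (simp add: dual_space_def Vector_Spaces.linear_iff vector_space_axioms)
qed

lemma dual_add: "f \<in> dual_space smul \<Longrightarrow> f (x + y) = f x + f y"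
  and dual_scale: "f \<in> dual_space smul \<Longrightarrow> f (smul c x) = c * f x"
  by (auto simp: dual_space_iff)

lemma dual_0 [simp]: "f \<in> dual_space smul \<Longrightarrow> f 0 = 0"
  using dual_scale[of f 0 0] by simp

lemma dual_minus: "f \<in> dual_space smul \<Longrightarrow> f (- x) = - f x"
  using dual_add[of f x "- x"] by (simp add: eq_neg_iff_add_eq_0 add.commute)

lemma W_add: "\<lbrakk>w \<in> W; w' \<in> W\<rbrakk> \<Longrightarrow> w + w' \<in> W"
  and W_minus: "w \<in> W \<Longrightarrow> - w \<in> W"
  and W_scale: "w \<in> W \<Longrightarrow> W_scale smul c w \<in> W"
  by (auto simp: W_space_def W_scale_def dual_space_iff algebra_simps mem_Times_iff)

subsection \<open>Topology of \<open>X\<close>\<close>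

lemma topspace_T: "topspace T = UNIV"
proof -
  have "(\<lambda>_. 0) \<in> dual_space smul"
    by (auto simp: dual_space_iff)
  then have "UNIV \<in> {f -` U |f U. f \<in> dual_space smul \<and> openin (F_topology v) U}"
    using openin_topspace[of "F_topology v"] by force
  then show ?thesis
    by (auto simp: X_topology_def)
qed

lemma openin_T_vimage:
  "\<lbrakk>f \<in> dual_space smul; openin (F_topology v) U\<rbrakk> \<Longrightarrow> openin T (f -` U)"
  unfolding X_topology_def by (rule topology_generated_by_Basis) blast

text \<open>Preimages under linear forms generate the topology, so continuity can be tested after
  composing with each form.\<close>

lemma continuous_map_into_T:
  assumes "\<And>f U. f \<in> dual_space smul \<Longrightarrow> openin (F_topology v) U \<Longrightarrow>
    openin Y {y \<in> topspace Y. f (g y) \<in> U}"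
  shows "continuous_map Y T g"
  unfolding X_topology_def
proof (rule continuous_on_generated_topo)
  show "g ` topspace Y \<subseteq> \<Union> {f -` U |f U. f \<in> dual_space smul \<and> openin (F_topology v) U}"
    using topspace_T unfolding X_topology_def by auto
qed (use assms in \<open>auto simp: vimage_def Collect_conj_eq Int_commute\<close>)

lemma continuous_map_translate: "continuous_map T T (\<lambda>x. x + a)"
proof (rule continuous_map_into_T)
  fix f U assume f: "f \<in> dual_space smul" "openin (F_topology v) U"
  have "{x \<in> topspace T. f (x + a) \<in> U} = f -` {c. c + f a \<in> U}"
    using f by (auto simp: topspace_T dual_add)
  then show "openin T {x \<in> topspace T. f (x + a) \<in> U}"
    using f openin_T_vimage openin_F_translate by metis
qed

lemma openin_translate:
  assumes "openin T V"
  shows "openin T {x. x + a \<in> V}"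
  using openin_continuous_map_preimage[OF continuous_map_translate assms] by (simp add: topspace_T)

lemma compactin_translate:
  assumes "compactin T K"
  shows "compactin T {x. x + a \<in> K}"
proof -
  \<comment> \<open>Written as a continuous image, the preimage inherits compactness.\<close>
  have "{x. x + a \<in> K} = (\<lambda>x. x + (- a)) ` K"
    by (auto simp: image_iff) (metis add_diff_cancel_right')
  then show ?thesis
    using image_compactin[OF assms continuous_map_translate] by metis
qed

lemma openin_chi_level:
  assumes f: "f \<in> dual_space smul"
  shows "openin T {x. chi (f x) = c}"
proof (subst openin_subopen, intro ballI)
  fix x assume x: "x \<in> {x. chi (f x) = c}"
  \<comment> \<open>The coset of the open kernel through \<open>f x\<close>, pulled back to
    \<open>X\<close>; \<open>chi\<close> is constant on it.\<close>
  let ?V = "f -` {a. a + (- f x) \<in> {b. chi b = 1}}"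
  have "openin T ?V"
    using f openin_T_vimage openin_F_translate[OF openin_kernel] by blast
  moreover have "x \<in> ?V"
    by simp
  moreover have "?V \<subseteq> {x. chi (f x) = c}"
  proof
    fix y assume "y \<in> ?V"
    then show "y \<in> {x. chi (f x) = c}"
      using chi_add[of "f y + (- f x)" "f x"] x by simp
  qed
  ultimately show "\<exists>V. openin T V \<and> x \<in> V \<and> V \<subseteq> {x. chi (f x) = c}"
    by blast
qed

section \<open>Coordinates and compact open boxes\<close>

lemma coordinate_dual: "(\<lambda>x. representation Basis x b) \<in> dual_space smul"
  unfolding dual_space_def
  using linear_representation[OF independent_Basis span_Basis] by simp

lemma sum_coordinates: "(\<Sum>b\<in>Basis. smul (representation Basis x b) b) = x"
  by (rule sum_representation_eq) (auto simp: independent_Basis finite_Basis span_Basis)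

text \<open>The closed ball around 0 for the maximum norm in coordinates.\<close>

definition box :: "real \<Rightarrow> 'x set" where
  "box r = {x. \<forall>b\<in>Basis. v (representation Basis x b) \<le> r}"

lemma openin_box:
  assumes "r > 0"
  shows "openin T (box r)"
proof -
  have "box r = topspace T \<inter> \<Inter> ((\<lambda>b. (\<lambda>x. representation Basis x b) -` {c. v c \<le> r}) ` Basis)"
    by (auto simp: box_def topspace_T)
  also have "openin T \<dots>"
    using openin_T_vimage[OF coordinate_dual openin_F_ball[OF assms]] finite_Basis
    by (cases "Basis = {}") (auto intro!: openin_Int openin_Inter)
  finally show ?thesis .
qed

lemma closedin_box:
  assumes "r > 0"
  shows "closedin T (box r)"
proof -
  have "openin (F_topology v) (- {c. v c \<le> r})"
    using closedin_F_ball[OF assms] by (simp add: closedin_def Compl_eq_Diff_UNIV)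
  then have "openin T (\<Union>b\<in>Basis. (\<lambda>x. representation Basis x b) -` (- {c. v c \<le> r}))"
    using openin_T_vimage[OF coordinate_dual] by blast
  moreover have "(\<Union>b\<in>Basis. (\<lambda>x. representation Basis x b) -` (- {c. v c \<le> r})) = UNIV - box r"
    by (auto simp: box_def)
  ultimately show ?thesis
    by (simp add: closedin_def topspace_T)
qed

text \<open>A linear form turns this map into a finite sum of coordinate projections scaled by
  constants, which is continuous.\<close>

lemma continuous_map_linear_combination:
  "continuous_map (product_topology (\<lambda>_. F_topology v) Basis) T (\<lambda>c. \<Sum>b\<in>Basis. smul (c b) b)"
  (is "continuous_map ?P T ?g")
proof (rule continuous_map_into_T)
  fix f U assume f: "f \<in> dual_space smul" "openin (F_topology v) U"
  have "f (\<Sum>b\<in>B. smul (c b) b) = (\<Sum>b\<in>B. c b * f b)" if "finite B" for B c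
    using that f(1) by (induction B rule: finite_induct) (auto simp: dual_add dual_scale)
  then have eq: "(\<lambda>c. f (?g c)) = (\<lambda>c. \<Sum>b\<in>Basis. c b * f b)"
    using finite_Basis by auto
  have "continuous_map ?P (F_topology v) (\<lambda>c. f (?g c))"
    unfolding eq by (intro continuous_map_F_sum continuous_map_F_mult_right finite_Basis
        continuous_map_product_projection)
  then show "openin ?P {c \<in> topspace ?P. f (?g c) \<in> U}"
    using f(2) by (rule openin_continuous_map_preimage)
qed

text \<open>A product of small balls of \<open>F\<close> is compact. Its image under the linear
  combination map is a compact set containing the box, and the box is closed.\<close>

lemma small_boxes_compact:
  obtains e where "e > 0" "\<forall>r. 0 < r \<longrightarrow> r \<le> e \<longrightarrow> compactin T (box r)"
proof -
  obtain e where e: "e > 0" "\<forall>r. 0 < r \<longrightarrow> r \<le> e \<longrightarrow> compactin (F_topology v) {x. v x \<le> r}"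
    using small_balls_compact .
  have "compactin T (box r)" if r: "0 < r" "r \<le> e" for r
  proof -
    let ?K = "PiE Basis (\<lambda>_. {x. v x \<le> r})" and ?g = "\<lambda>c. \<Sum>b\<in>Basis. smul (c b) b"
    have "box r \<subseteq> ?g ` ?K"
    proof
      fix x assume "x \<in> box r"
      then have "(\<lambda>b\<in>Basis. representation Basis x b) \<in> ?K"
        by (auto simp: box_def)
      moreover have "x = ?g (\<lambda>b\<in>Basis. representation Basis x b)"
        using sum_coordinates[of x] by simp
      ultimately show "x \<in> ?g ` ?K"
        by (intro image_eqI)
    qed
    moreover have "compactin T (?g ` ?K)"
      by (intro image_compactin[OF _ continuous_map_linear_combination])
        (simp add: compactin_PiE e r)
    ultimately show ?thesis
      using closed_compactin closedin_box[OF r(1)] by blast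
  qed
  with e that show thesis by blast
qed

text \<open>The indicator of a compact open box around 0, small enough to miss \<open>z\<close> when
  \<open>z\<close> is nonzero.\<close>

lemma separating_schwartz_function:
  obtains \<Phi> where "\<Phi> \<in> S" "\<Phi> 0 = 1" "z \<noteq> 0 \<longrightarrow> \<Phi> z = 0"
proof -
  obtain e where e: "e > 0" "\<forall>r. 0 < r \<longrightarrow> r \<le> e \<longrightarrow> compactin T (box r)"
    using small_boxes_compact .
  have "\<exists>r. 0 < r \<and> r \<le> e \<and> (z \<noteq> 0 \<longrightarrow> z \<notin> box r)"
  proof (cases "z = 0")
    case True
    then show ?thesis using e(1) by auto
  next
    case False
    then have "\<exists>b\<in>Basis. representation Basis z b \<noteq> 0"
      using sum_coordinates[of z] by (metis (mono_tags, lifting) scale_zero_left sum.neutral)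
    then obtain b where b: "b \<in> Basis" "v (representation Basis z b) > 0"
      using nonneg eq_0_iff by (metis less_eq_real_def)
    \<comment> \<open>The first bound keeps the box compact; the second excludes \<open>z\<close>
      through its nonzero coordinate.\<close>
    let ?r = "min e (v (representation Basis z b) / 2)"
    have "0 < ?r" "?r \<le> e" "?r < v (representation Basis z b)"
      using b e by (auto simp: min_def)
    with b show ?thesis
      unfolding box_def by (intro exI[of _ ?r]) force
  qed
  then obtain r where r: "0 < r" "r \<le> e" "z \<noteq> 0 \<longrightarrow> z \<notin> box r"
    by blast
  let ?\<Phi> = "\<lambda>x. if x \<in> box r then 1 else 0 :: 'r"
  have "?\<Phi> \<in> S"
  proof (rule schwartz_space_closed_support[OF topspace_T])
    have "{x. ?\<Phi> x = c} = (if c = 1 then box r else if c = 0 then - box r else {})" for c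
      by auto
    then show "\<forall>c. openin T {x. ?\<Phi> x = c}"
      using closedin_box[OF r(1)] openin_box[OF r(1)]
      by (simp add: closedin_def topspace_T Compl_eq_Diff_UNIV)
    show "compactin T (box r)"
      using e r by blast
  qed auto
  moreover have "0 \<in> box r"
    using r(1) dual_0[OF coordinate_dual] by (simp add: box_def)
  ultimately show thesis
    using that[of ?\<Phi>] r(3) by simp
qed

lemma schwartz_translate:
  assumes "\<Phi> \<in> S"
  shows "(\<lambda>x. \<Phi> (x + a)) \<in> S"
  using assms openin_translate[of "{x. \<Phi> x = _}" a] compactin_translate[of "{x. \<Phi> x \<noteq> 0}" a]
  by (auto simp: schwartz_space_iff topspace_T)

lemma schwartz_mult_chi:
  assumes "\<Phi> \<in> S" "f \<in> dual_space smul"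
  shows "(\<lambda>x. \<Phi> x * chi (f x)) \<in> S"
proof (rule schwartz_space_closed_support[OF topspace_T])
  show "\<forall>c. openin T {x. \<Phi> x * chi (f x) = c}"
    using assms openin_chi_level openin_level_combine[where h = "(*)" and f = \<Phi>]
    by (auto simp: schwartz_space_iff topspace_T)
  show "compactin T {x. \<Phi> x \<noteq> 0}"
    using assms by (auto simp: schwartz_space_iff topspace_T)
qed auto


subsection \<open>The representation \<open>U\<close>\<close>

abbreviation "U \<equiv> U_map v smul chi"

lemma carrier_A: "carrier A = W \<times> {t. t dvd 1}"
  by (simp add: A_group_def)

lemma U_apply:
  "\<Phi> \<in> S \<Longrightarrow> U ((y, y'), t) \<Phi> = (\<lambda>x. t * \<Phi> (x + y) * chi (y' x))"
  by (simp add: U_map_def)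

lemma U_mem:
  assumes "a \<in> carrier A" "\<Phi> \<in> S"
  shows "U a \<Phi> \<in> S"
proof -
  obtain y y' t where a: "a = ((y, y'), t)"
    by (metis prod.exhaust)
  with assms have "y' \<in> dual_space smul"
    by (simp add: carrier_A W_space_def)
  with assms show ?thesis
    unfolding a using schwartz_mult_chi[OF schwartz_space_scale[OF topspace_T schwartz_translate]]
    by (simp add: U_apply)
qed

text \<open>Translating by \<open>y\<close> turns \<open>chi (z' x)\<close> into
  \<open>chi (z' (x + y))\<close>. The extra factor \<open>chi (z' y)\<close> is exactly the cocycle
  in the group law.\<close>

lemma U_mult:
  assumes "a \<in> carrier A" "b \<in> carrier A" "\<Phi> \<in> S"
  shows "U a (U b \<Phi>) = U (a \<otimes>\<^bsub>A\<^esub> b) \<Phi>"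
proof -
  obtain y y' t z z' s where ab: "a = ((y, y'), t)" "b = ((z, z'), s)"
    by (metis prod.exhaust)
  with assms have "z' \<in> dual_space smul"
    by (simp add: carrier_A W_space_def)
  moreover have "(\<lambda>x. s * \<Phi> (x + z) * chi (z' x)) \<in> S"
    using U_mem[OF assms(2,3)] assms(3) by (simp add: ab U_apply)
  ultimately show ?thesis
    using assms(3)
    by (simp add: ab A_group_def B_form_def U_apply dual_add chi_add algebra_simps)
qed

lemma A_inverse:
  assumes "a \<in> carrier A"
  obtains b where "b \<in> carrier A" "a \<otimes>\<^bsub>A\<^esub> b = (0, 1)" "b \<otimes>\<^bsub>A\<^esub> a = (0, 1)"
proof -
  obtain y y' t where a: "a = ((y, y'), t)"
    by (metis prod.exhaust)
  with assms have y': "y' \<in> dual_space smul" and "t dvd 1"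
    by (auto simp: carrier_A W_space_def)
  then obtain u where u: "1 = t * u"
    by (auto elim: dvdE)
  \<comment> \<open>\<open>u\<close> inverts \<open>t\<close>, and \<open>chi (y' y)\<close> cancels
    the cocycle value of \<open>w\<close> and \<open>- w\<close>.\<close>
  let ?b = "((- y, - y'), u * chi (y' y))"
  have "?b \<in> carrier A"
  proof -
    have "u * chi (y' y) dvd 1 * 1"
      using u chi_unit by (intro mult_dvd_mono) (auto simp: dvd_def mult.commute)
    then show ?thesis
      using W_minus[of "(y, y')"] y' by (simp add: carrier_A W_space_def)
  qed
  moreover have "chi (- y' y) * chi (y' y) = 1"
    by (rule chi_minus)
  then have "u * chi (y' y) * t * chi (- y' y) = 1"
    using u by (metis mult.assoc mult.commute mult.left_neutral)
  then have "a \<otimes>\<^bsub>A\<^esub> ?b = (0, 1)" "?b \<otimes>\<^bsub>A\<^esub> a = (0, 1)"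
    using y' by (auto simp: a A_group_def B_form_def dual_minus zero_prod_def mult_ac)
  ultimately show thesis
    using that by blast
qed

lemma U_one: "\<Phi> \<in> S \<Longrightarrow> U (0, 1) \<Phi> = \<Phi>"
  using U_apply[of \<Phi> 0 0 1] by (simp add: zero_prod_def)

lemma group_G: "group G"
proof -
  have "subgroup (carrier G) (BijGroup S)"
    using subgroup_Aut_module[OF schwartz_space_add[OF topspace_T] schwartz_space_scale[OF topspace_T]] .
  then show ?thesis
    using subgroup.subgroup_is_group[OF _ group_BijGroup] by (simp add: Aut_module_def)
qed

lemma U_in_G:
  assumes "a \<in> carrier A"
  shows "U a \<in> carrier G"
proof -
  obtain b where b: "b \<in> carrier A" "a \<otimes>\<^bsub>A\<^esub> b = (0, 1)" "b \<otimes>\<^bsub>A\<^esub> a = (0, 1)"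
    using A_inverse[OF assms] .
  \<comment> \<open>The operator of an inverse in \<open>A\<close> is a two-sided inverse on
    \<open>S\<close>.\<close>
  have "bij_betw (U a) S S"
    by (rule bij_betw_byWitness[of _ "U b"]) (use assms b in \<open>auto simp: U_mult U_one U_mem\<close>)
  moreover have "U a \<in> extensional S"
    by (auto simp: U_map_def split: prod.splits)
  moreover obtain y y' t where a: "a = ((y, y'), t)"
    by (metis prod.exhaust)
  ultimately show ?thesis
    by (auto simp: Aut_module_def Bij_def a U_apply schwartz_space_add schwartz_space_scale topspace_T
        algebra_simps fun_eq_iff)
qed

section \<open>Faithfulness of \<open>U\<close>\<close>

lemma inj_on_U: "inj_on U (carrier A)"
proof (rule inj_onI)
  fix a b assume a: "a \<in> carrier A" and b: "b \<in> carrier A" and eq: "U a = U b"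
  obtain y y' t z z' s where ab: "a = ((y, y'), t)" "b = ((z, z'), s)"
    by (metis prod.exhaust)
  have dual: "y' \<in> dual_space smul" "z' \<in> dual_space smul" and units: "t dvd 1" "s dvd 1"
    using a b by (auto simp: ab carrier_A W_space_def)
  have nz: "t \<noteq> 0" "s \<noteq> 0"
    using units by auto
  have pointwise: "t * \<Phi> (x + y) * chi (y' x) = s * \<Phi> (x + z) * chi (z' x)" if "\<Phi> \<in> S" for \<Phi> x
    using fun_cong[OF fun_cong[OF eq, of \<Phi>], of x] that by (simp add: ab U_apply)
  have "y = z"
  proof (rule ccontr)
    assume "y \<noteq> z"
    then obtain \<Phi> where "\<Phi> \<in> S" "\<Phi> 0 = 1" "\<Phi> (z - y) = 0"
      using separating_schwartz_function[of "z - y"] by (metis eq_iff_diff_eq_0)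
    then show False
      \<comment> \<open>At \<open>- y\<close> the left side is a unit times
        \<open>\<Phi> 0 = 1\<close>, while the right side contains
        \<open>\<Phi> (z - y) = 0\<close>.\<close>
      using pointwise[of \<Phi> "- y"] nz by simp
  qed
  have tw: "t * chi (y' x) = s * chi (z' x)" for x
  proof -
    obtain \<Phi> where \<Phi>: "\<Phi> \<in> S" "\<Phi> 0 = 1"
      using separating_schwartz_function by metis
    then show ?thesis
      \<comment> \<open>The translate of \<open>\<Phi>\<close> takes the value 1 at
        \<open>x + y\<close>, so only the scalars and characters remain.\<close>
      using pointwise[OF schwartz_translate[OF \<Phi>(1)], of x "- (x + y)"] \<open>y = z\<close> by simp
  qed
  have "t = s"
    using tw[of 0] dual by simp
  have "y' = z'"
  proof
    fix x show "y' x = z' x"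
    proof (rule ccontr)
      assume ne: "y' x \<noteq> z' x"
      have "chi c = 1" for c
      proof -
        \<comment> \<open>Scaled so that \<open>y'\<close> and \<open>z'\<close> differ by exactly
          \<open>c\<close> there; as \<open>c\<close> is arbitrary, \<open>chi\<close> would be
          trivial.\<close>
        let ?u = "smul (c / (y' x - z' x)) x"
        have "y' ?u = c + z' ?u"
          using dual ne by (simp add: dual_scale field_simps)
        then show ?thesis
          using tw[of ?u] \<open>t = s\<close> nz by (simp add: chi_add)
      qed
      then show False using nontrivial by blast
    qed
  qed
  with \<open>y = z\<close> \<open>t = s\<close> show "a = b" by (simp add: ab)
qed


subsection \<open>The normalizer and \<open>\<pi>\<^sub>0\<close>\<close>

abbreviation "N \<equiv> carrier (BB0_group v smul chi)"

lemma AA_subset: "AA_group v smul chi \<subseteq> carrier G"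
  using U_in_G by (auto simp: AA_group_def)

lemma N_eq: "N = normalizer G (AA_group v smul chi)"
  by (simp add: BB0_group_def Let_def)

lemma subgroup_N: "subgroup N G"
  unfolding N_eq using group.normalizer_imp_subgroup[OF group_G AA_subset] .

lemma BB0_group_eq: "BB0_group v smul chi = G\<lparr>carrier := N\<rparr>"
  by (simp add: BB0_group_def Let_def)

lemma group_BB0: "group (BB0_group v smul chi)"
  using subgroup.subgroup_is_group[OF subgroup_N group_G] BB0_group_eq by simp

lemma N_subset: "s \<in> N \<Longrightarrow> s \<in> carrier G"
  using subgroup.mem_carrier[OF subgroup_N] .

text \<open>Conjugation by \<open>s\<close> maps the image of \<open>U\<close> to itself, so the
  inverse taken in \<open>pi0_map\<close> is applied to a point of that image.\<close>

lemma U_pi0: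
  assumes s: "s \<in> N" and a: "a \<in> carrier A"
  shows "pi0_map v smul chi s a \<in> carrier A"
    and "U (pi0_map v smul chi s a) = s \<otimes>\<^bsub>G\<^esub> U a \<otimes>\<^bsub>G\<^esub> inv\<^bsub>G\<^esub> s"
proof -
  have "s <#\<^bsub>G\<^esub> AA_group v smul chi #>\<^bsub>G\<^esub> inv\<^bsub>G\<^esub> s = AA_group v smul chi"
    using s AA_subset by (simp add: N_eq normalizer_def stabilizer_def)
  moreover have "s \<otimes>\<^bsub>G\<^esub> U a \<otimes>\<^bsub>G\<^esub> inv\<^bsub>G\<^esub> s \<in> s <#\<^bsub>G\<^esub> AA_group v smul chi #>\<^bsub>G\<^esub> inv\<^bsub>G\<^esub> s"
    using a by (auto simp: l_coset_def r_coset_def AA_group_def)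
  ultimately have mem: "s \<otimes>\<^bsub>G\<^esub> U a \<otimes>\<^bsub>G\<^esub> inv\<^bsub>G\<^esub> s \<in> U ` carrier A"
    by (simp add: AA_group_def)
  show "pi0_map v smul chi s a \<in> carrier A"
    using the_inv_into_into[OF inj_on_U mem order_refl] a by (simp add: pi0_map_def Let_def)
  show "U (pi0_map v smul chi s a) = s \<otimes>\<^bsub>G\<^esub> U a \<otimes>\<^bsub>G\<^esub> inv\<^bsub>G\<^esub> s"
    using f_the_inv_into_f[OF inj_on_U mem] a by (simp add: pi0_map_def Let_def)
qed

text \<open>Conjugating by \<open>r\<close> and then by \<open>s\<close> is conjugating by their
  product; injectivity of \<open>U\<close> carries this back to \<open>A\<close>.\<close>

lemma pi0_mult:
  assumes s: "s \<in> N" "r \<in> N" and a: "a \<in> carrier A"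
  shows "pi0_map v smul chi (s \<otimes>\<^bsub>G\<^esub> r) a = pi0_map v smul chi s (pi0_map v smul chi r a)"
proof -
  interpret G: group G by (rule group_G)
  have sr: "s \<otimes>\<^bsub>G\<^esub> r \<in> N"
    using subgroup.m_closed[OF subgroup_N] s by blast
  have "s \<otimes>\<^bsub>G\<^esub> (r \<otimes>\<^bsub>G\<^esub> U a \<otimes>\<^bsub>G\<^esub> inv\<^bsub>G\<^esub> r) \<otimes>\<^bsub>G\<^esub> inv\<^bsub>G\<^esub> s
      = s \<otimes>\<^bsub>G\<^esub> r \<otimes>\<^bsub>G\<^esub> U a \<otimes>\<^bsub>G\<^esub> inv\<^bsub>G\<^esub> (s \<otimes>\<^bsub>G\<^esub> r)"
    using N_subset[OF s(1)] N_subset[OF s(2)] U_in_G[OF a] by (simp add: G.m_assoc G.inv_mult_group)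
  then have "U (pi0_map v smul chi (s \<otimes>\<^bsub>G\<^esub> r) a) = U (pi0_map v smul chi s (pi0_map v smul chi r a))"
    using U_pi0[OF s(1) U_pi0(1)[OF s(2) a]] U_pi0[OF s(2) a] U_pi0[OF sr a] by simp
  then show ?thesis
    using inj_onD[OF inj_on_U] U_pi0(1)[OF sr a] U_pi0(1)[OF s(1) U_pi0(1)[OF s(2) a]] by blast
qed

lemma pi0_one:
  assumes "a \<in> carrier A"
  shows "pi0_map v smul chi \<one>\<^bsub>G\<^esub> a = a"
proof -
  interpret G: group G by (rule group_G)
  have one: "\<one>\<^bsub>G\<^esub> \<in> N"
    using subgroup.one_closed[OF subgroup_N] .
  have "U (pi0_map v smul chi \<one>\<^bsub>G\<^esub> a) = U a"
    using U_pi0(2)[OF one assms] U_in_G[OF assms] by simp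
  then show ?thesis
    using inj_onD[OF inj_on_U] U_pi0(1)[OF one assms] assms by blast
qed


subsection \<open>The symplectic group and \<open>\<mu>\<close>\<close>

lemma subgroup_Sp: "subgroup (carrier (Sp smul)) (BijGroup W)"
proof (rule subgroup_BijGroupI)
  show "carrier (Sp smul) \<subseteq> Bij W"
    by (auto simp: Sp_def)
  show "(\<lambda>w\<in>W. w) \<in> carrier (Sp smul)"
    by (simp add: Sp_def id_Bij W_add W_scale)
next
  fix g h assume "g \<in> carrier (Sp smul)" "h \<in> carrier (Sp smul)"
  then show "compose W g h \<in> carrier (Sp smul)"
    by (simp add: Sp_def compose_Bij compose_eq W_add W_scale Bij_mem)
next
  fix g h assume g: "g \<in> carrier (Sp smul)" and h: "h \<in> Bij W"
    and gh: "\<And>x. x \<in> W \<Longrightarrow> g (h x) = x" "\<And>x. x \<in> W \<Longrightarrow> h (g x) = x"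
  have "h (w + w') = h w + h w'" if "w \<in> W" "w' \<in> W" for w w'
  proof -
    have "g (h w + h w') = w + w'"
      using g h gh that by (simp add: Sp_def Bij_mem)
    then show ?thesis
      using gh(2) W_add h that by (metis Bij_mem)
  qed
  moreover have "h (W_scale smul c w) = W_scale smul c (h w)" if "w \<in> W" for c w
  proof -
    have "g (W_scale smul c (h w)) = W_scale smul c w"
      using g h gh that by (simp add: Sp_def Bij_mem)
    then show ?thesis
      using gh(2) W_scale h that by (metis Bij_mem)
  qed
  moreover have "B_form (h w) (h w') - B_form (h w') (h w) = B_form w w' - B_form w' w"
    if "w \<in> W" "w' \<in> W" for w w'
  proof -
    \<comment> \<open>Invariance under \<open>g\<close>, read at the preimages \<open>h w\<close>
      and \<open>h w'\<close>.\<close>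
    have "B_form (g (h w)) (g (h w')) - B_form (g (h w')) (g (h w))
        = B_form (h w) (h w') - B_form (h w') (h w)"
      using g h that by (simp add: Sp_def Bij_mem)
    then show ?thesis using gh that by simp
  qed
  ultimately show "h \<in> carrier (Sp smul)"
    using h by (simp add: Sp_def)
qed

lemma group_Sp: "group (Sp smul)"
  using subgroup.subgroup_is_group[OF subgroup_Sp group_BijGroup] by (simp add: Sp_def)

lemma Sp_mem: "\<lbrakk>\<sigma> \<in> carrier (Sp smul); w \<in> W\<rbrakk> \<Longrightarrow> \<sigma> w \<in> W"
  by (simp add: Sp_def Bij_mem)

lemma mu_apply:
  "(w, t) \<in> carrier A \<Longrightarrow> mu_map smul chi \<sigma> (w, t) = (\<sigma> w, chi (f_quad \<sigma> w) * t)"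
  by (simp add: mu_map_def)

lemma mu_mem:
  assumes "\<sigma> \<in> carrier (Sp smul)" "a \<in> carrier A"
  shows "mu_map smul chi \<sigma> a \<in> carrier A"
proof (cases a)
  case (Pair w t)
  then have "chi (f_quad \<sigma> w) * t dvd 1 * 1"
    using assms chi_unit by (intro mult_dvd_mono) (auto simp: carrier_A)
  then show ?thesis
    using assms by (auto simp: Pair mu_apply carrier_A Sp_mem)
qed

lemma mu_mult:
  assumes "\<sigma> \<in> carrier (Sp smul)" "\<tau> \<in> carrier (Sp smul)" "a \<in> carrier A"
  shows "mu_map smul chi (\<sigma> \<otimes>\<^bsub>Sp smul\<^esub> \<tau>) a = mu_map smul chi \<sigma> (mu_map smul chi \<tau> a)"
proof (cases a)
  case (Pair w t)
  then have w: "w \<in> W"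
    using assms by (simp add: carrier_A)
  show ?thesis
    using mu_mem[OF assms(2,3)] assms w
    by (simp add: Pair mu_apply mult_Sp f_quad_compose chi_add compose_eq mult_ac)
qed

lemma mu_one:
  assumes "a \<in> carrier A"
  shows "mu_map smul chi \<one>\<^bsub>Sp smul\<^esub> a = a"
proof (cases a)
  case (Pair w t)
  then have "\<one>\<^bsub>Sp smul\<^esub> w = w"
    using assms by (simp add: carrier_A Sp_def BijGroup_def)
  then show ?thesis
    using assms by (simp add: Pair mu_apply f_quad_def)
qed

text \<open>The first component at \<open>(w, 1)\<close> recovers \<open>\<sigma> w\<close>; outside
  \<open>W\<close> both maps are \<open>undefined\<close>.\<close>

lemma inj_on_mu: "inj_on (mu_map smul chi) (carrier (Sp smul))"
proof (rule inj_onI)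
  fix \<sigma> \<tau> assume \<sigma>: "\<sigma> \<in> carrier (Sp smul)" "\<tau> \<in> carrier (Sp smul)"
    and eq: "mu_map smul chi \<sigma> = mu_map smul chi \<tau>"
  have "\<sigma> w = \<tau> w" if "w \<in> W" for w
    using fun_cong[OF eq, of "(w, 1)"] that by (simp add: mu_apply carrier_A)
  moreover have "\<sigma> \<in> extensional W" "\<tau> \<in> extensional W"
    using \<sigma> by (auto simp: Sp_def Bij_def)
  ultimately show "\<sigma> = \<tau>"
    by (intro extensionalityI)
qed


subsection \<open>The metaplectic group\<close>

text \<open>Both maps are restricted to \<open>carrier A\<close>, so equality of functions reduces
  to equality there.\<close>

lemma mem_Mp_iff:
  "(\<sigma>, s) \<in> carrier (Mp v smul chi) \<longleftrightarrow> \<sigma> \<in> carrier (Sp smul) \<and> s \<in> N \<and>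
    (\<forall>a\<in>carrier A. mu_map smul chi \<sigma> a = pi0_map v smul chi s a)"
  by (auto simp: Mp_def mu_map_def pi0_map_def fun_eq_iff)

text \<open>The pairs on which two multiplicative actions on \<open>carrier A\<close> agree are
  closed under products and inverses.\<close>

lemma subgroup_Mp: "subgroup (carrier (Mp v smul chi)) (Sp smul \<times>\<times> BB0_group v smul chi)"
proof -
  interpret Sp: group "Sp smul" by (rule group_Sp)
  interpret BB0: group "BB0_group v smul chi" by (rule group_BB0)
  interpret P: group "Sp smul \<times>\<times> BB0_group v smul chi"
    by (rule DirProd_group[OF group_Sp group_BB0])
  have mult_eq: "s \<otimes>\<^bsub>BB0_group v smul chi\<^esub> r = s \<otimes>\<^bsub>G\<^esub> r" for s r
    by (simp add: BB0_group_def Let_def)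
  have one_eq: "\<one>\<^bsub>BB0_group v smul chi\<^esub> = \<one>\<^bsub>G\<^esub>"
    by (simp add: BB0_group_def Let_def)
  show ?thesis
  proof (rule P.subgroupI)
    show "carrier (Mp v smul chi) \<subseteq> carrier (Sp smul \<times>\<times> BB0_group v smul chi)"
      by (auto simp: mem_Mp_iff)
    have "(\<one>\<^bsub>Sp smul\<^esub>, \<one>\<^bsub>BB0_group v smul chi\<^esub>) \<in> carrier (Mp v smul chi)"
      using BB0.one_closed by (auto simp: mem_Mp_iff mu_one pi0_one one_eq)
    then show "carrier (Mp v smul chi) \<noteq> {}"
      by blast
  next
    fix x y assume "x \<in> carrier (Mp v smul chi)" "y \<in> carrier (Mp v smul chi)"
    moreover obtain \<sigma> s \<tau> r where "x = (\<sigma>, s)" "y = (\<tau>, r)"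
      by fastforce
    ultimately show "x \<otimes>\<^bsub>Sp smul \<times>\<times> BB0_group v smul chi\<^esub> y \<in> carrier (Mp v smul chi)"
      using BB0.m_closed[of s r] U_pi0(1) by (auto simp: mem_Mp_iff mult_eq mu_mult pi0_mult)
  next
    fix x assume "x \<in> carrier (Mp v smul chi)"
    moreover obtain \<sigma> s where x: "x = (\<sigma>, s)"
      by fastforce
    ultimately have \<sigma>: "\<sigma> \<in> carrier (Sp smul)" and s: "s \<in> N"
      and lift: "\<And>a. a \<in> carrier A \<Longrightarrow> mu_map smul chi \<sigma> a = pi0_map v smul chi s a"
      by (auto simp: mem_Mp_iff)
    let ?\<sigma>' = "inv\<^bsub>Sp smul\<^esub> \<sigma>" and ?s' = "inv\<^bsub>BB0_group v smul chi\<^esub> s"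
    have "mu_map smul chi ?\<sigma>' a = pi0_map v smul chi ?s' a" if a: "a \<in> carrier A" for a
    proof -
      \<comment> \<open>\<open>\<sigma>\<close> and \<open>s\<close> act alike and send
        \<open>?b\<close> to \<open>a\<close>, so the inverse of \<open>\<sigma>\<close> must send
        \<open>a\<close> back to \<open>?b\<close>.\<close>
      let ?b = "pi0_map v smul chi ?s' a"
      have b: "?b \<in> carrier A"
        using U_pi0(1) s a by simp
      have "mu_map smul chi \<sigma> ?b = pi0_map v smul chi (s \<otimes>\<^bsub>BB0_group v smul chi\<^esub> ?s') a"
        using s a by (simp add: lift[OF b] mult_eq pi0_mult del: BB0.r_inv)
      also have "\<dots> = a"
        using s a by (simp add: one_eq pi0_one)
      finally have "mu_map smul chi ?\<sigma>' a = mu_map smul chi (?\<sigma>' \<otimes>\<^bsub>Sp smul\<^esub> \<sigma>) ?b"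
        by (simp only: mu_mult[OF Sp.inv_closed[OF \<sigma>] \<sigma> b])
      also have "\<dots> = ?b"
        using \<sigma> mu_one[OF b] by simp
      finally show ?thesis .
    qed
    then show "inv\<^bsub>Sp smul \<times>\<times> BB0_group v smul chi\<^esub> x \<in> carrier (Mp v smul chi)"
      using \<sigma> s by (simp add: x inv_DirProd[OF group_Sp group_BB0] mem_Mp_iff)
  qed
qed

lemma group_Mp: "group (Mp v smul chi)"
  using subgroup.subgroup_is_group[OF subgroup_Mp DirProd_group[OF group_Sp group_BB0]]
  by (simp add: Mp_def)

lemma group_hom_snd: "group_hom (Mp v smul chi) (BB0_group v smul chi) snd"
proof -
  have "snd \<in> hom (Mp v smul chi) (BB0_group v smul chi)"
    by (auto simp: hom_def Mp_def DirProd_def)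
  then show ?thesis
    using group_Mp group_BB0 by (simp add: group_hom_def group_hom_axioms_def)
qed

text \<open>The second component determines \<open>mu_map smul chi \<sigma>\<close> through
  \<open>pi0_map\<close>, and hence \<open>\<sigma>\<close>.\<close>

lemma inj_on_snd_Mp: "inj_on snd (carrier (Mp v smul chi))"
  using inj_on_mu by (auto simp: inj_on_def Mp_def)

end

theorem mainTheorem6:
  fixes v :: "'f::field \<Rightarrow> real"
    and smul :: "'f \<Rightarrow> 'x::ab_group_add \<Rightarrow> 'x"
    and chi :: "'f \<Rightarrow> 'r::idom"
    and p q :: nat
  assumes "nonarch_local_field v"
    and "CHAR('f) \<noteq> 2"
    and "ring_characteristic (residue_field v) = p"
    and "card (carrier (residue_field v)) = q"
    and "(of_nat p :: 'r) dvd 1"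
    and "\<exists>r::'r. r ^ 2 = of_nat q"
    and "smooth_character v chi"
    and "\<exists>x. chi x \<noteq> 1"
    and "\<exists>Basis. finite_dimensional_vector_space smul Basis"
  shows "group_hom (Mp v smul chi) (BB0_group v smul chi) snd
    \<and> subgroup (carrier (BB0_group v smul chi))
        (Aut_module (schwartz_space (X_topology v smul)))
    \<and> inj_on snd (carrier (Mp v smul chi))
    \<and> (\<forall>(\<sigma>, s) \<in> carrier (Mp v smul chi). pi0_map v smul chi s = mu_map smul chi \<sigma>)"
proof -
  obtain Basis where "finite_dimensional_vector_space smul Basis"
    using assms(9) by blast
  then interpret schwartz_representation v smul Basis chi
    using assms(1,7,8)
    by (simp add: schwartz_representation_def schwartz_representation_axioms_def)
  \<comment> \<open>The lifting property is the condition that cuts out the fibre product.\<close>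
  have "\<forall>(\<sigma>, s) \<in> carrier (Mp v smul chi). pi0_map v smul chi s = mu_map smul chi \<sigma>"
    by (auto simp: Mp_def)
  then show ?thesis
    using group_hom_snd subgroup_N inj_on_snd_Mp by blast
qed

end
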